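(* Let $p$ be a prime, $n\geq 3$ an integer, and $A\in M_2(\mathbb{F}_p)$ a matrix such that $A\neq cE$ for every $c\in\mathbb{F}_p$. Let $B\in M_2(\mathbb{F}_p)$ satisfy $B^n=A$, and put $a=\operatorname{tr}B$. Then there is $b\in\mathbb{F}_p$ with $b^n=\det A$, $P_n(a,b)=\operatorname{tr}A$, $Q_{n-1}(a,b)\neq0$ and $$B=\frac{A+b\,Q_{n-2}(a,b)\,E}{Q_{n-1}(a,b)}.$$
   Context: $M_2(\mathbb{F}_p)$ is the ring of $2\times2$ matrices over $\mathbb{F}_p$, and $E$ is the identity matrix. For $k\ge 0$ let $h_k(x,y)=\sum_{j=0}^{k}x^jy^{k-j}$ be the complete symmetric polynomial of degree $k$ in two variables and, for $k\geq 1$, let $p_k(x,y)=x^k+y^k$ be the power sum. By the fundamental theorem of symmetric polynomials there are unique polynomials $Q_k,P_k\in\mathbb{F}_p[u,v]$ with $Q_k(x+y,xy)=h_k(x,y)$ and $P_k(x+y,xy)=p_k(x,y)$. *)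

theory Defs
  imports
    "Berlekamp_Zassenhaus.Finite_Field"
    "Jordan_Normal_Form.Determinant"
begin

definition mat_trace :: "'a::comm_monoid_add mat \<Rightarrow> 'a" where
  "mat_trace A = (\<Sum>i<dim_row A. A $$ (i, i))"

text \<open>
  Polynomials in two variables over \<open>R\<close> are elements of \<open>R[x][y]\<close>: in \<^typ>\<open>'a poly poly\<close> the
  first variable is the inner one, and the second variable is the outer one.
  \<open>eval2 h F s t\<close> is \<open>F(s,t)\<close>, with the coefficients of \<open>F\<close> mapped by \<open>h\<close>.
\<close>

definition eval2 :: "('a::zero \<Rightarrow> 'b::comm_semiring_1) \<Rightarrow> 'a poly poly \<Rightarrow> 'b \<Rightarrow> 'b \<Rightarrow> 'b" where
  "eval2 h F s t = eval_poly (\<lambda>c. eval_poly h c s) F t"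

definition var1 :: "'a::comm_semiring_1 poly poly" where
  "var1 = [:[:0, 1:]:]"

definition var2 :: "'a::comm_semiring_1 poly poly" where
  "var2 = [:0, 1:]"

definition subst2 :: "'a::comm_semiring_1 poly poly \<Rightarrow> 'a poly poly \<Rightarrow> 'a poly poly \<Rightarrow> 'a poly poly" where
  "subst2 F s t = eval2 (\<lambda>c. [:[:c:]:]) F s t"

definition complete_sym :: "nat \<Rightarrow> 'a::comm_semiring_1 poly poly" where
  "complete_sym k = (\<Sum>j\<le>k. var1 ^ j * var2 ^ (k - j))"

definition power_sum :: "nat \<Rightarrow> 'a::comm_semiring_1 poly poly" where
  "power_sum k = var1 ^ k + var2 ^ k"

definition Q_poly :: "nat \<Rightarrow> 'a::idom poly poly" where
  "Q_poly k = (THE F. subst2 F (var1 + var2) (var1 * var2) = complete_sym k)"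

definition P_poly :: "nat \<Rightarrow> 'a::idom poly poly" where
  "P_poly k = (THE F. subst2 F (var1 + var2) (var1 * var2) = power_sum k)"

text \<open>The definite descriptions above are well-defined.\<close>

lemma const_hom: "comm_ring_hom (\<lambda>c::'a::idom. [:[:c:]:])"
  by unfold_locales (auto simp: one_pCons)

lemma eval_poly_hom:
  fixes h :: "'a::comm_ring_1 \<Rightarrow> 'b::comm_ring_1"
  assumes "comm_ring_hom h"
  shows "comm_ring_hom (\<lambda>c. eval_poly h c s)"
proof -
  from assms interpret h: comm_ring_hom h .
  interpret m: map_poly_comm_ring_hom h ..
  show ?thesis
    by unfold_locales (auto simp: eval_poly_def hom_distribs)
qed

lemma subst2_hom: "comm_ring_hom (\<lambda>F. subst2 F s (t :: 'a::idom poly poly))"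
  unfolding subst2_def eval2_def by (intro eval_poly_hom const_hom)

lemma eval_poly_pCons: "h 0 = 0 \<Longrightarrow> eval_poly h (pCons a F) s = h a + s * eval_poly h F s"
  by (cases "pCons a F = 0") (auto simp: eval_poly_def Polynomial.map_poly_pCons)

lemma eval_poly_zero: "eval_poly h 0 s = 0"
  by (simp add: eval_poly_def)

lemma eval_poly_one: "h 0 = 0 \<Longrightarrow> h 1 = 1 \<Longrightarrow> eval_poly h 1 s = 1"
  by (simp add: eval_poly_def)

lemma eval_const_one: "eval_poly (\<lambda>c::'a::idom. [:[:c:]:]) 1 s = 1"
  by (rule eval_poly_one) (simp_all flip: one_pCons)

lemma subst2_var1: "subst2 var1 s t = (s :: 'a::idom poly poly)"
  by (simp add: subst2_def eval2_def var1_def eval_poly_pCons eval_poly_zero eval_const_one flip: one_pCons)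

lemma subst2_var2: "subst2 var2 s t = (t :: 'a::idom poly poly)"
  by (simp add: subst2_def eval2_def var2_def eval_poly_pCons eval_poly_zero eval_const_one)

lemma subst2_pCons:
  "subst2 (pCons g F) s t = eval_poly (\<lambda>c. [:[:c:]:]) g s + t * subst2 F s t"
  by (simp add: subst2_def eval2_def eval_poly_pCons eval_poly_zero)

lemma inner_at_0:
  "poly (eval_poly (\<lambda>c. [:[:c:]:]) g (var1 + var2)) 0 = (g :: 'a::idom poly)"
  by (induction g) (simp_all add: eval_poly_pCons eval_poly_zero var1_def var2_def)

lemma sym_subst_eq_0:
  fixes F :: "'a::idom poly poly"
  shows "subst2 F (var1 + var2) (var1 * var2) = 0 \<Longrightarrow> F = 0"
proof (induction F)
  case (pCons g F)
  have "poly (subst2 (pCons g F) (var1 + var2) (var1 * var2)) 0 = g"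
    unfolding subst2_pCons poly_add inner_at_0 by (simp add: var2_def)
  with pCons.prems have g: "g = 0" by simp
  have "var1 * var2 * subst2 F (var1 + var2) (var1 * var2) = 0"
    using pCons.prems by (simp add: subst2_pCons g eval_poly_zero del: mult_eq_0_iff)
  moreover have "var1 * var2 \<noteq> (0 :: 'a poly poly)" by (simp add: var1_def var2_def)
  ultimately have "F = 0" using pCons.IH by (metis mult_eq_0_iff)
  with g show ?case by simp
qed simp

lemma sym_subst_inj:
  fixes F G :: "'a::idom poly poly"
  assumes "subst2 F (var1 + var2) (var1 * var2) = subst2 G (var1 + var2) (var1 * var2)"
  shows "F = G"
proof -
  interpret comm_ring_hom "\<lambda>F::'a poly poly. subst2 F (var1 + var2) (var1 * var2)"
    by (rule subst2_hom)
  have "subst2 (F - G) (var1 + var2) (var1 * var2) = 0" using assms by (simp add: hom_minus)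
  from sym_subst_eq_0[OF this] show ?thesis by simp
qed

lemma sym_subst_exists_rec:
  fixes f :: "nat \<Rightarrow> 'a::idom poly poly"
  assumes "\<And>k. f (k + 2) = (var1 + var2) * f (k + 1) - var1 * var2 * f k"
    and "\<exists>F. subst2 F (var1 + var2) (var1 * var2) = f 0"
    and "\<exists>F. subst2 F (var1 + var2) (var1 * var2) = f 1"
  shows "\<exists>F. subst2 F (var1 + var2) (var1 * var2) = f k"
proof -
  interpret comm_ring_hom "\<lambda>F::'a poly poly. subst2 F (var1 + var2) (var1 * var2)"
    by (rule subst2_hom)
  show ?thesis
  proof (induction k rule: induct_nat_012)
    case (ge2 k)
    then obtain F G where
      "subst2 F (var1 + var2) (var1 * var2) = f k" "subst2 G (var1 + var2) (var1 * var2) = f (k + 1)"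
      by auto
    then have "subst2 (var1 * G - var2 * F) (var1 + var2) (var1 * var2) = f (k + 2)"
      unfolding assms(1) by (simp add: hom_minus hom_mult subst2_var1 subst2_var2)
    then show ?case by auto
  qed (use assms in auto)
qed

lemma complete_sym_0: "complete_sym 0 = 1"
  by (simp add: complete_sym_def)

lemma complete_sym_Suc:
  "complete_sym (Suc k) = var2 * complete_sym k + (var1 ^ Suc k :: 'a::comm_semiring_1 poly poly)"
proof -
  have "(\<Sum>j\<le>k. var1 ^ j * var2 ^ (Suc k - j)) = var2 * (\<Sum>j\<le>k. var1 ^ j * var2 ^ (k - j) :: 'a poly poly)"
    unfolding sum_distrib_left by (rule sum.cong) (auto simp: Suc_diff_le mult_ac)
  then show ?thesis by (simp add: complete_sym_def)
qed

lemma Q_poly_ex1: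
  "\<exists>!F. subst2 F (var1 + var2) (var1 * var2) = (complete_sym k :: 'a::idom poly poly)"
proof -
  interpret comm_ring_hom "\<lambda>F::'a poly poly. subst2 F (var1 + var2) (var1 * var2)"
    by (rule subst2_hom)
  have "\<exists>F. subst2 F (var1 + var2) (var1 * var2) = (complete_sym k :: 'a poly poly)"
  proof (rule sym_subst_exists_rec)
    show "complete_sym (k + 2) = (var1 + var2) * complete_sym (k + 1) - var1 * var2 * (complete_sym k :: 'a poly poly)" for k
      by (simp add: complete_sym_Suc algebra_simps)
    show "\<exists>F. subst2 F (var1 + var2) (var1 * var2) = (complete_sym 0 :: 'a poly poly)"
      by (rule exI[of _ 1]) (simp add: complete_sym_0)
    show "\<exists>F. subst2 F (var1 + var2) (var1 * var2) = (complete_sym 1 :: 'a poly poly)"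
      by (rule exI[of _ var1]) (simp add: complete_sym_0 complete_sym_Suc subst2_var1)
  qed
  then show ?thesis using sym_subst_inj by metis
qed

lemma P_poly_ex1:
  "\<exists>!F. subst2 F (var1 + var2) (var1 * var2) = (power_sum k :: 'a::idom poly poly)"
proof -
  interpret comm_ring_hom "\<lambda>F::'a poly poly. subst2 F (var1 + var2) (var1 * var2)"
    by (rule subst2_hom)
  have "\<exists>F. subst2 F (var1 + var2) (var1 * var2) = (power_sum k :: 'a poly poly)"
  proof (rule sym_subst_exists_rec)
    show "power_sum (k + 2) = (var1 + var2) * power_sum (k + 1) - var1 * var2 * (power_sum k :: 'a poly poly)" for k
      by (simp add: power_sum_def algebra_simps)
    show "\<exists>F. subst2 F (var1 + var2) (var1 * var2) = (power_sum 0 :: 'a poly poly)"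
      by (rule exI[of _ "1 + 1"]) (simp only: power_sum_def hom_add hom_one power_0)
    show "\<exists>F. subst2 F (var1 + var2) (var1 * var2) = (power_sum 1 :: 'a poly poly)"
      by (rule exI[of _ var1]) (simp add: power_sum_def subst2_var1)
  qed
  then show ?thesis using sym_subst_inj by metis
qed

lemma subst2_Q_poly: "subst2 (Q_poly k) (var1 + var2) (var1 * var2) = complete_sym k"
  unfolding Q_poly_def by (rule theI'[OF Q_poly_ex1])

lemma subst2_P_poly: "subst2 (P_poly k) (var1 + var2) (var1 * var2) = power_sum k"
  unfolding P_poly_def by (rule theI'[OF P_poly_ex1])

end

(* Take b = det B. The Cayley-Hamilton relation B^2 = a B - b E and the recurrence
   Q_(k+2) = u Q_(k+1) - v Q_k give B^n = Q_(n-1)(a,b) B - b Q_(n-2)(a,b) E. Since A is not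
   scalar, Q_(n-1)(a,b) is nonzero and the relation can be solved for B; its trace gives
   P_n(a,b) because P_n = u Q_(n-1) - 2 v Q_(n-2). *)
theory Submission
  imports Defs
begin

text \<open>Turns identities between the polynomials \<open>Q_poly\<close> and \<open>P_poly\<close>
  into identities between their values at a point.\<close>

lemma eval2_id_hom: "comm_ring_hom (\<lambda>F :: 'a::idom poly poly. eval2 id F s t)"
  unfolding eval2_def by (intro eval_poly_hom) (unfold_locales, auto)

lemma eval2_id_var1: "eval2 id var1 s t = (s :: 'a::idom)"
  by (simp add: eval2_def var1_def eval_poly_pCons eval_poly_zero eval_poly_one)

lemma eval2_id_var2: "eval2 id var2 s t = (t :: 'a::idom)"
  by (simp add: eval2_def var2_def eval_poly_pCons eval_poly_zero eval_poly_one)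

lemma Q_poly_0: "Q_poly 0 = (1 :: 'a::idom poly poly)"
proof -
  interpret comm_ring_hom "\<lambda>F :: 'a poly poly. subst2 F (var1 + var2) (var1 * var2)"
    by (rule subst2_hom)
  show ?thesis
    by (rule sym_subst_inj) (simp add: subst2_Q_poly complete_sym_0)
qed

lemma Q_poly_1: "Q_poly (Suc 0) = (var1 :: 'a::idom poly poly)"
  by (rule sym_subst_inj)
    (simp add: subst2_Q_poly subst2_var1 complete_sym_0 complete_sym_Suc add.commute)

text \<open>Substituting u = x + y and v = xy is injective, so this is the relation h_(k+2) = (x +
  y) h_(k+1) - xy h_k pulled back along it.\<close>

lemma Q_poly_Suc_Suc:
  "Q_poly (Suc (Suc k)) = var1 * Q_poly (Suc k) - var2 * (Q_poly k :: 'a::idom poly poly)"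
proof -
  interpret comm_ring_hom "\<lambda>F :: 'a poly poly. subst2 F (var1 + var2) (var1 * var2)"
    by (rule subst2_hom)
  show ?thesis
    by (rule sym_subst_inj)
      (simp add: subst2_Q_poly subst2_var1 subst2_var2 hom_minus hom_mult complete_sym_Suc algebra_simps)
qed

text \<open>By the recurrence for h, the right-hand side is h_(k+2) - xy h_k, where all mixed
  monomials cancel.\<close>

lemma power_sum_complete_sym:
  "power_sum (Suc (Suc k)) =
    (var1 + var2) * complete_sym (Suc k) - 2 * (var1 * var2) * (complete_sym k :: 'a::comm_ring_1 poly poly)"
proof (induction k)
  case 0
  show ?case by (simp add: power_sum_def complete_sym_0 complete_sym_Suc algebra_simps)
next
  case (Suc k)
  \<comment> \<open>Chosen to parallel \<open>complete_sym_Suc\<close>: both recursions multiply by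
    y and add a correction, and the corrections, all multiples of x^(k+2), cancel.\<close>
  have "power_sum (Suc (Suc (Suc k))) =
      var2 * power_sum (Suc (Suc k)) + (var1 - var2) * (var1 :: 'a poly poly) ^ Suc (Suc k)"
    by (simp add: power_sum_def algebra_simps)
  also have "\<dots> = (var1 + var2) * complete_sym (Suc (Suc k)) - 2 * (var1 * var2) * complete_sym (Suc k)"
    unfolding Suc.IH complete_sym_Suc[of "Suc k"] complete_sym_Suc[of k]
    by (simp add: algebra_simps)
  finally show ?case .
qed

lemma P_poly_Suc_Suc:
  "P_poly (Suc (Suc k)) = var1 * Q_poly (Suc k) - 2 * var2 * (Q_poly k :: 'a::idom poly poly)"
proof -
  interpret comm_ring_hom "\<lambda>F :: 'a poly poly. subst2 F (var1 + var2) (var1 * var2)"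
    by (rule subst2_hom)
  show ?thesis
    by (rule sym_subst_inj)
      (simp only: subst2_Q_poly subst2_P_poly subst2_var1 subst2_var2 hom_minus hom_mult hom_numeral
        power_sum_complete_sym mult.assoc)
qed

lemma mat_trace_2:
  assumes "B \<in> carrier_mat 2 2"
  shows "mat_trace B = B $$ (0, 0) + B $$ (1, 1)"
  using assms by (simp add: mat_trace_def numeral_2_eq_2)

lemma det_mat_2:
  assumes "B \<in> carrier_mat 2 2"
  shows "det B = B $$ (0, 0) * B $$ (1, 1) - B $$ (0, 1) * B $$ (1, 0)"
proof -
  \<comment> \<open>The minor is a single entry, in the row other than \<open>i\<close>; that row is
    \<open>1 - i\<close> because \<open>i\<close> is 0 or 1.\<close>
  have "det (mat_delete B i 0) = B $$ (1 - i, 1)" if "i < 2" for i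
    using assms that by (subst det_single) (auto simp: mat_delete_def)
  then show ?thesis
    using assms by (simp add: laplace_expansion_column[of B 2 0] cofactor_def numeral_2_eq_2 mult.commute)
qed

lemma cayley_hamilton_2:
  fixes B :: "'a::comm_ring_1 mat"
  assumes B: "B \<in> carrier_mat 2 2"
  shows "B * B = mat_trace B \<cdot>\<^sub>m B + (- det B) \<cdot>\<^sub>m 1\<^sub>m 2"
proof (rule eq_matI)
  fix i j assume "i < dim_row (mat_trace B \<cdot>\<^sub>m B + (- det B) \<cdot>\<^sub>m 1\<^sub>m 2)"
    and "j < dim_col (mat_trace B \<cdot>\<^sub>m B + (- det B) \<cdot>\<^sub>m 1\<^sub>m 2)"
  then have "i = 0 \<or> i = 1" "j = 0 \<or> j = 1" by auto
  then show "(B * B) $$ (i, j) = (mat_trace B \<cdot>\<^sub>m B + (- det B) \<cdot>\<^sub>m 1\<^sub>m 2) $$ (i, j)"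
    using B by (auto simp: mat_trace_2[OF B] det_mat_2[OF B] scalar_prod_def numeral_2_eq_2 algebra_simps)
qed (use B in auto)

text \<open>Starting at exponent 2 keeps both indices of Q natural. Multiplying by B and reducing
  B^2 by Cayley-Hamilton changes the coefficient of B exactly as the recurrence for Q
  prescribes.\<close>

lemma pow_mat_2:
  fixes B :: "'a::idom mat"
  assumes B: "B \<in> carrier_mat 2 2"
  defines "a \<equiv> mat_trace B" and "b \<equiv> det B"
  shows "B ^\<^sub>m Suc (Suc k) =
    eval2 id (Q_poly (Suc k)) a b \<cdot>\<^sub>m B + (- (b * eval2 id (Q_poly k) a b)) \<cdot>\<^sub>m 1\<^sub>m 2"
proof (induction k)
  case 0
  interpret comm_ring_hom "\<lambda>F :: 'a poly poly. eval2 id F a b" by (rule eval2_id_hom)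
  \<comment> \<open>As Q_0 = 1 and Q_1 = u, this case is Cayley-Hamilton itself.\<close>
  show ?case
    unfolding Q_poly_0 Q_poly_1 eval2_id_var1 hom_one
    using B cayley_hamilton_2[OF B] by (simp add: a_def b_def)
next
  case (Suc k)
  interpret comm_ring_hom "\<lambda>F :: 'a poly poly. eval2 id F a b" by (rule eval2_id_hom)
  define q where "q i = eval2 id (Q_poly i) a b" for i
  have q: "q (Suc (Suc k)) = a * q (Suc k) - b * q k"
    by (simp add: q_def Q_poly_Suc_Suc hom_minus hom_mult eval2_id_var1 eval2_id_var2)
  have "B ^\<^sub>m Suc (Suc (Suc k)) = (q (Suc k) \<cdot>\<^sub>m B + (- (b * q k)) \<cdot>\<^sub>m 1\<^sub>m 2) * B"
    unfolding q_def Suc.IH[symmetric] by simp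
  also have "\<dots> = q (Suc k) \<cdot>\<^sub>m (B * B) + (- (b * q k)) \<cdot>\<^sub>m B"
    using B by (simp add: add_mult_distrib_mat[of _ 2 2] mult_smult_assoc_mat[of _ 2 2])
  also have "\<dots> = q (Suc (Suc k)) \<cdot>\<^sub>m B + (- (b * q (Suc k))) \<cdot>\<^sub>m 1\<^sub>m 2"
    unfolding cayley_hamilton_2[OF B] a_def[symmetric] b_def[symmetric] q
    using B by (intro eq_matI) (auto simp: algebra_simps)
  finally show ?case unfolding q_def .
qed

lemma det_pow_mat:
  assumes "B \<in> carrier_mat m m"
  shows "det (B ^\<^sub>m k) = det B ^ k"
  using assms by (induction k) (auto simp: det_mult[of _ m] pow_carrier_mat mult.commute)

theorem theorem31:
  fixes A B :: "'p::prime_card mod_ring mat"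
    and a :: "'p mod_ring"
    and n :: nat
  assumes "n \<ge> 3"
    and "A \<in> carrier_mat 2 2"
    and "\<forall>c :: 'p mod_ring. A \<noteq> c \<cdot>\<^sub>m 1\<^sub>m 2"
    and "B \<in> carrier_mat 2 2"
    and "B ^\<^sub>m n = A"
    and "a = mat_trace B"
  shows "\<exists>b :: 'p mod_ring.
    b ^ n = det A \<and>
    eval2 id (P_poly n) a b = mat_trace A \<and>
    eval2 id (Q_poly (n - 1)) a b \<noteq> 0 \<and>
    B = inverse (eval2 id (Q_poly (n - 1)) a b) \<cdot>\<^sub>m
          (A + (b * eval2 id (Q_poly (n - 2)) a b) \<cdot>\<^sub>m 1\<^sub>m 2)"
proof -
  \<comment> \<open>No truncation occurs, as n is at least 3, so \<open>n - 1\<close> is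
    \<open>Suc k\<close>.\<close>
  define k where "k = n - 2"
  have n: "n = Suc (Suc k)" using \<open>n \<ge> 3\<close> by (simp add: k_def)
  note A = \<open>A \<in> carrier_mat 2 2\<close> and B = \<open>B \<in> carrier_mat 2 2\<close>
  define b where "b = det B"
  define q where "q i = eval2 id (Q_poly i) a b" for i
  interpret comm_ring_hom "\<lambda>F :: 'p mod_ring poly poly. eval2 id F a b" by (rule eval2_id_hom)
  have A_eq: "A = q (Suc k) \<cdot>\<^sub>m B + (- (b * q k)) \<cdot>\<^sub>m 1\<^sub>m 2"
    using pow_mat_2[OF B, of k] assms(5,6) unfolding n q_def b_def by simp
  have "b ^ n = det A"
    using det_pow_mat[OF B, of n] assms(5) by (simp add: b_def)
  moreover have "eval2 id (P_poly n) a b = mat_trace A"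
  proof -
    have "eval2 id (P_poly n) a b = a * q (Suc k) - 2 * b * q k"
      by (simp add: n q_def P_poly_Suc_Suc hom_minus hom_mult hom_numeral eval2_id_var1 eval2_id_var2)
    \<comment> \<open>The factor 2 in the formula for P_n is the trace of E.\<close>
    also have "\<dots> = mat_trace A"
      unfolding mat_trace_2[OF A] assms(6) mat_trace_2[OF B] using B by (simp add: A_eq algebra_simps)
    finally show ?thesis .
  qed
  moreover have q_nz: "q (Suc k) \<noteq> 0"
  proof
    assume "q (Suc k) = 0"
    then have "A = (- (b * q k)) \<cdot>\<^sub>m 1\<^sub>m 2"
      unfolding A_eq using B by (intro eq_matI) auto
    with assms(3) show False by blast
  qed
  \<comment> \<open>Entrywise, the multiples of E cancel; reassociating then brings the inverse next
    to \<open>q (Suc k)\<close>.\<close>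
  moreover have "B = inverse (q (Suc k)) \<cdot>\<^sub>m (A + (b * q k) \<cdot>\<^sub>m 1\<^sub>m 2)"
    unfolding A_eq using B q_nz by (intro eq_matI) (auto simp: mult.assoc[symmetric])
  ultimately show ?thesis
    by (intro exI[of _ b]) (simp add: n q_def)
qed

end
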